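(* Let $M$ be a finite geometric semilattice of rank $n$, and let $cM$, $\underline{M}$ and, for $S\in\underline{M}$, the posets $\underline{M}^S$ and $M_S$ be as defined in the context. Then \[ \chi_M(t)=\sum_{S\in\underline{M}}\chi_{\underline{M}^S}(t)\,\chi_{M_S}(1). \]
   Context: A ranked lattice $L$ is semimodular if $\operatorname{rank}(s)+\operatorname{rank}(t)\ge \operatorname{rank}(s\wedge t)+\operatorname{rank}(s\vee t)$ for all $s,t$; it is atomistic if every element is a join of atoms; a geometric lattice is a (finite) semimodular atomistic ranked lattice. For a ranked meet semilattice $M$, a set $S$ of atoms is independent if it has a join $\bigvee S$ and $\operatorname{rank}(\bigvee S)=|S|$. $M$ is a geometric semilattice if (a) every principal order ideal of $M$ is a geometric lattice, and (b) whenever $S$ is an independent set of atoms and $\operatorname{rank}(t)<\operatorname{rank}(\bigvee S)$, there is $a\in S$ with $a\not\le t$ such that $t\vee a$ exists. Cone and centralization: let $A=\{a_1,\dots,a_k\}$ be the atoms of $M$ and $a_0$ a new symbol. For $s\in M$ let $A_s=\{a\in A: a\le s\}$, $P_s=\{a\in A: a \text{ and } s \text{ have no common upper bound in } M\}$, and $\underline{A_s}=A_s\cup P_s\cup\{a_0\}$. The cone is $cM=\{A_s:s\in M\}\cup\{\underline{A_s}:s\in M\}$ ordered by inclusion (a geometric lattice), and the centralization is the subposet $\underline{M}=\{\underline{A_s}:s\in M\}$. For $S\in\underline{M}$, $\underline{M}^S=\{T\in\underline{M}: S\subseteq T\}$ (principal order filter), and $M_S=\{X\in cM: X\subseteq S\}\setminus\underline{M}$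 (the localization). For a (semi)lattice $P$ with minimum $\hat 0$ and rank $N$ (maximum rank of an element, ranks measured from $\hat0$), its characteristic polynomial is $\chi_P(t)=\sum_{s\in P}\mu_P(\hat 0,s)\,t^{N-\operatorname{rank}(s)}$, with $\mu_P$ the Möbius function of $P$. *)

theory Defs
  imports "HOL-Computational_Algebra.Polynomial" "HOL-Algebra.Lattice"
begin

section \<open>Ranked posets\<close>

definition subposet :: "('a, 'b) gorder_scheme \<Rightarrow> 'a set \<Rightarrow> ('a, 'b) gorder_scheme" where
  "subposet L A = L\<lparr>carrier := A\<rparr>"

definition principal_ideal :: "('a, 'b) gorder_scheme \<Rightarrow> 'a \<Rightarrow> ('a, 'b) gorder_scheme" where
  "principal_ideal L s = subposet L {x \<in> carrier L. x \<sqsubseteq>\<^bsub>L\<^esub> s}"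

definition principal_filter :: "('a, 'b) gorder_scheme \<Rightarrow> 'a \<Rightarrow> ('a, 'b) gorder_scheme" where
  "principal_filter L s = subposet L {x \<in> carrier L. s \<sqsubseteq>\<^bsub>L\<^esub> x}"

definition covered_by :: "('a, 'b) gorder_scheme \<Rightarrow> 'a \<Rightarrow> 'a \<Rightarrow> bool" where
  "covered_by L x y \<longleftrightarrow> x \<in> carrier L \<and> y \<in> carrier L \<and> x \<sqsubset>\<^bsub>L\<^esub> y \<and>
     \<not> (\<exists>z \<in> carrier L. x \<sqsubset>\<^bsub>L\<^esub> z \<and> z \<sqsubset>\<^bsub>L\<^esub> y)"

definition atoms :: "('a, 'b) gorder_scheme \<Rightarrow> 'a set" where
  "atoms L = {a \<in> carrier L. covered_by L \<bottom>\<^bsub>L\<^esub> a}"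

text \<open>The rank of an element is the length (number of elements minus one) of a longest chain of
  elements below it. In a ranked poset, all maximal chains from the minimum to \<open>x\<close> have this length.
  Both rank functions are meaningful for finite posets only (because of \<^const>\<open>Max\<close>).\<close>

definition rank :: "('a, 'b) gorder_scheme \<Rightarrow> 'a \<Rightarrow> nat" where
  "rank L x = Max (card ` {C. C \<subseteq> carrier (principal_ideal L x) \<and>
                             Complete_Partial_Order.chain (le L) C}) - 1"

definition poset_rank :: "('a, 'b) gorder_scheme \<Rightarrow> nat" where
  "poset_rank L = Max (rank L ` carrier L)"

locale ranked_poset = partial_order L + weak_partial_order_bottom L for L (structure) +
  assumes rank_covered_by: "covered_by L x y \<Longrightarrow> rank L y = rank L x + 1"


section \<open>Geometric lattices and geometric semilattices\<close>

locale geometric_lattice = Lattice.lattice L + ranked_poset L for L (structure) +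
  assumes finite_carrier: "finite (carrier L)"
    and semimodular: "\<lbrakk>s \<in> carrier L; t \<in> carrier L\<rbrakk> \<Longrightarrow>
          rank L s + rank L t \<ge> rank L (s \<sqinter> t) + rank L (s \<squnion> t)"
    and atomistic: "x \<in> carrier L \<Longrightarrow> \<exists>S \<subseteq> atoms L. is_lub L x S"

definition has_join :: "('a, 'b) gorder_scheme \<Rightarrow> 'a set \<Rightarrow> bool" where
  "has_join L S \<longleftrightarrow> (\<exists>j. is_lub L j S)"

definition independent_atoms :: "('a, 'b) gorder_scheme \<Rightarrow> 'a set \<Rightarrow> bool" where
  "independent_atoms L S \<longleftrightarrow> S \<subseteq> atoms L \<and> has_join L S \<and> rank L (\<Squnion>\<^bsub>L\<^esub> S) = card S"

locale geometric_semilattice = lower_semilattice M + ranked_poset M for M (structure) +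
  assumes geometric_ideals: "s \<in> carrier M \<Longrightarrow> geometric_lattice (principal_ideal M s)"
    and independent_extension:
      "\<lbrakk>independent_atoms M S; t \<in> carrier M; rank M t < rank M (\<Squnion> S)\<rbrakk> \<Longrightarrow>
         \<exists>a \<in> S. \<not> a \<sqsubseteq> t \<and> has_join M {t, a}"


section \<open>Moebius function and characteristic polynomial\<close>

text \<open>The guard on \<open>L\<close> ensures termination; outside of finite posets the value is irrelevant.\<close>

function mobius :: "('a, 'b) gorder_scheme \<Rightarrow> 'a \<Rightarrow> 'a \<Rightarrow> int" where
  "mobius L x y =
     (if partial_order L \<and> finite (carrier L) \<and> x \<in> carrier L \<and> y \<in> carrier L \<and> x \<sqsubseteq>\<^bsub>L\<^esub> y then
        if x = y then 1
        else - (\<Sum>z \<in> {z \<in> carrier L. x \<sqsubseteq>\<^bsub>L\<^esub> z \<and> z \<sqsubset>\<^bsub>L\<^esub> y}. mobius L x z)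
      else 0)"
  by pat_completeness auto
termination
proof (relation "measure (\<lambda>(L, x, y). card {z \<in> carrier L. z \<sqsubseteq>\<^bsub>L\<^esub> y})", goal_cases)
  case (2 L x y z)
  then interpret partial_order L by simp
  have "y \<notin> {w \<in> carrier L. w \<sqsubseteq>\<^bsub>L\<^esub> z}"
    using 2 by (auto simp: lless_def eq_is_equal intro: le_antisym)
  moreover have "y \<in> {w \<in> carrier L. w \<sqsubseteq>\<^bsub>L\<^esub> y}"
    using 2 by auto
  moreover have "{w \<in> carrier L. w \<sqsubseteq>\<^bsub>L\<^esub> z} \<subseteq> {w \<in> carrier L. w \<sqsubseteq>\<^bsub>L\<^esub> y}"
    using 2 by (auto simp: lless_def intro: le_trans)
  ultimately have "{w \<in> carrier L. w \<sqsubseteq>\<^bsub>L\<^esub> z} \<subset> {w \<in> carrier L. w \<sqsubseteq>\<^bsub>L\<^esub> y}"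
    by blast
  moreover have "finite {w \<in> carrier L. w \<sqsubseteq>\<^bsub>L\<^esub> y}"
    using 2 by simp
  ultimately show ?case
    by (simp add: psubset_card_mono)
qed simp

declare mobius.simps [simp del]

definition characteristic_poly :: "('a, 'b) gorder_scheme \<Rightarrow> int poly" where
  "characteristic_poly L =
     (\<Sum>s \<in> carrier L. monom (mobius L \<bottom>\<^bsub>L\<^esub> s) (poset_rank L - rank L s))"


section \<open>Cone, centralization and localization\<close>

definition inclusion_poset :: "'a set set \<Rightarrow> 'a set gorder" where
  "inclusion_poset F = \<lparr>carrier = F, eq = (=), le = (\<subseteq>)\<rparr>"

definition atoms_below :: "('a, 'b) gorder_scheme \<Rightarrow> 'a \<Rightarrow> 'a set" where
  "atoms_below M s = {a \<in> atoms M. a \<sqsubseteq>\<^bsub>M\<^esub> s}"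

definition atoms_apart :: "('a, 'b) gorder_scheme \<Rightarrow> 'a \<Rightarrow> 'a set" where
  "atoms_apart M s = {a \<in> atoms M. Upper M {a, s} = {}}"

text \<open>The elements of the cone are sets of type \<^typ>\<open>'a option set\<close>: an atom \<open>a\<close> of the
  semilattice is represented by \<^term>\<open>Some a\<close> and the new symbol $a_0$ by \<^term>\<open>None\<close>.
  The sets $A_s$ and $\underline{A_s}$ are \<open>lower_flat M s\<close> and \<open>upper_flat M s\<close>.\<close>

definition lower_flat :: "('a, 'b) gorder_scheme \<Rightarrow> 'a \<Rightarrow> 'a option set" where
  "lower_flat M s = Some ` atoms_below M s"

definition upper_flat :: "('a, 'b) gorder_scheme \<Rightarrow> 'a \<Rightarrow> 'a option set" where
  "upper_flat M s = Some ` (atoms_below M s \<union> atoms_apart M s) \<union> {None}"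

definition cone :: "('a, 'b) gorder_scheme \<Rightarrow> 'a option set gorder" where
  "cone M = inclusion_poset (lower_flat M ` carrier M \<union> upper_flat M ` carrier M)"

definition centralization :: "('a, 'b) gorder_scheme \<Rightarrow> 'a option set gorder" where
  "centralization M = subposet (cone M) (upper_flat M ` carrier M)"

definition localization :: "('a, 'b) gorder_scheme \<Rightarrow> 'a option set \<Rightarrow> 'a option set gorder" where
  "localization M S =
     subposet (cone M) ({X \<in> carrier (cone M). X \<subseteq> S} - carrier (centralization M))"

end

theory Submission
  imports Defs
begin

text \<open>Sort the elements of \<open>M\<close> by the set $\underline{A_x}$. If $g(T)$ is the sum of
  $\mu_M(\hat 0,x)$ over all $x$ with $\underline{A_x} = T$, then $\chi_M(t)$ is the sum of the
  $g(T)\,t^{n - \mathrm{rank}(T)}$. The inclusion $A_x \subseteq S$ is equivalent to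
  $\underline{A_x} \subseteq S$ for $S$ in $\underline M$, so
  $\chi_{M_S}(1) = \sum_{T \subseteq S} g(T)$, and the theorem is Moebius inversion on
  $\underline M$. Both this equivalence and the fact that ranks in the filters of
  $\underline M$ are differences of ranks in \<open>M\<close> come from repeated exchange between
  independent sets of atoms.\<close>


section \<open>Subposets\<close>

text \<open>No rank in the cone is ever computed; every exponent is pulled back to \<open>M\<close>.
  This requires that elements with equal \<open>upper_flat\<close> have equal rank, since only then
  does a fibre sum g(T) carry a single power. In the filter above the class of x, the class of y has
  rank rank(y) - rank(x), and the filter itself has rank n - rank(x), because every element of
  \<open>M\<close> lies below one of rank n. The offset rank(x) cancels, so the power attached to a
  class T is the same in all filters containing it, and the inversion can be carried out for each T
  separately. The obstacle is that elements with nested classes need not be comparable in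
  \<open>M\<close>, or even have a common upper bound. Containment of classes therefore cannot be
  handled by joins; it is reduced to containment of one independent set of atoms, to which axiom (b)
  applies. That axiom fits because A_s together with P_s consists exactly of the atoms that cannot
  enlarge s.\<close>

lemma subposet_simps [simp]:
  "carrier (subposet L A) = A" "le (subposet L A) = le L" "eq (subposet L A) = eq L"
  by (simp_all add: subposet_def)

lemma carrier_principal_ideal [simp]:
  "carrier (principal_ideal L s) = {x \<in> carrier L. x \<sqsubseteq>\<^bsub>L\<^esub> s}"
  and le_principal_ideal [simp]: "le (principal_ideal L s) = le L"
  and eq_principal_ideal [simp]: "eq (principal_ideal L s) = eq L"
  by (simp_all add: principal_ideal_def)

lemma carrier_principal_filter [simp]:
  "carrier (principal_filter L s) = {x \<in> carrier L. s \<sqsubseteq>\<^bsub>L\<^esub> x}"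
  and le_principal_filter [simp]: "le (principal_filter L s) = le L"
  and eq_principal_filter [simp]: "eq (principal_filter L s) = eq L"
  by (simp_all add: principal_filter_def)

lemma inclusion_poset_simps [simp]:
  "carrier (inclusion_poset F) = F" "le (inclusion_poset F) = (\<subseteq>)" "eq (inclusion_poset F) = (=)"
  by (simp_all add: inclusion_poset_def)

lemma partial_order_inclusion_poset: "partial_order (inclusion_poset F)"
  by unfold_locales auto

lemma partial_order_subposet:
  assumes "partial_order L" "A \<subseteq> carrier L"
  shows "partial_order (subposet L A)"
proof -
  interpret partial_order L by fact
  interpret sub: weak_partial_order "subposet L A"
    unfolding subposet_def
    by (rule weak_partial_order_subset) (use assms(2) in \<open>auto intro: weak_partial_order_axioms\<close>)
  show ?thesis
    by unfold_locales (simp add: eq_is_equal)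
qed

lemma bottom_eqI:
  assumes "partial_order L" "b \<in> carrier L" "\<And>x. x \<in> carrier L \<Longrightarrow> b \<sqsubseteq>\<^bsub>L\<^esub> x"
  shows "\<bottom>\<^bsub>L\<^esub> = b"
proof -
  interpret partial_order L by fact
  have "least L b (carrier L)"
    using assms by (simp add: least_def)
  thus ?thesis
    unfolding bottom_def using least_unique by blast
qed


section \<open>Moebius inversion\<close>

lemma mobius_refl:
  assumes "partial_order L" "finite (carrier L)" "x \<in> carrier L"
  shows "mobius L x x = 1"
proof -
  interpret partial_order L by fact
  show ?thesis using assms by (subst mobius.simps) simp
qed

lemma sum_mobius_interval:
  assumes "partial_order L" "finite (carrier L)" "x \<in> carrier L" "y \<in> carrier L" "x \<sqsubseteq>\<^bsub>L\<^esub> y"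
  shows "(\<Sum>z \<in> {z \<in> carrier L. x \<sqsubseteq>\<^bsub>L\<^esub> z \<and> z \<sqsubseteq>\<^bsub>L\<^esub> y}. mobius L x z) = (if x = y then 1 else 0)"
proof (cases "x = y")
  interpret partial_order L by fact
  case True
  hence "{z \<in> carrier L. x \<sqsubseteq>\<^bsub>L\<^esub> z \<and> z \<sqsubseteq>\<^bsub>L\<^esub> y} = {x}"
    using assms by (auto intro: le_antisym)
  thus ?thesis using True mobius_refl[OF assms(1-3)] by simp
next
  interpret partial_order L by fact
  case False
  have "{z \<in> carrier L. x \<sqsubseteq>\<^bsub>L\<^esub> z \<and> z \<sqsubseteq>\<^bsub>L\<^esub> y} = insert y {z \<in> carrier L. x \<sqsubseteq>\<^bsub>L\<^esub> z \<and> z \<sqsubset>\<^bsub>L\<^esub> y}"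
    using assms by (auto simp: lless_def eq_is_equal)
  moreover have "y \<notin> {z \<in> carrier L. x \<sqsubseteq>\<^bsub>L\<^esub> z \<and> z \<sqsubset>\<^bsub>L\<^esub> y}"
    by (auto simp: lless_def eq_is_equal)
  ultimately show ?thesis
    using assms False by (simp add: mobius.simps[of L x y])
qed

text \<open>\<open>mobius\<close> is defined by recursion in its upper argument, whereas the
  inversion below sums over the lower one. The two recursions are linked by evaluating one double
  sum over pairs z \<le> w of the interval in both orders.\<close>

lemma sum_mobius_interval_dual:
  assumes po: "partial_order L" and fin: "finite (carrier L)"
    and "x \<in> carrier L" "y \<in> carrier L" "x \<sqsubseteq>\<^bsub>L\<^esub> y"
  shows "(\<Sum>z \<in> {z \<in> carrier L. x \<sqsubseteq>\<^bsub>L\<^esub> z \<and> z \<sqsubseteq>\<^bsub>L\<^esub> y}. mobius L z y) = (if x = y then 1 else 0)"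
  using assms(3-)
proof (induction "card {z \<in> carrier L. z \<sqsubseteq>\<^bsub>L\<^esub> y}" arbitrary: y rule: less_induct)
  case less
  interpret partial_order L by fact
  define I where "I v w = {z \<in> carrier L. v \<sqsubseteq>\<^bsub>L\<^esub> z \<and> z \<sqsubseteq>\<^bsub>L\<^esub> w}" for v w
  define h where "h w = (\<Sum>z \<in> I x w. mobius L z w)" for w
  have finI: "finite (I v w)" for v w
    using fin by (simp add: I_def)
  show ?case
  proof (cases "x = y")
    case True
    hence "I x y = {x}"
      using less.prems by (auto simp: I_def intro: le_antisym)
    thus ?thesis
      using True mobius_refl[OF po fin] less.prems by (simp add: I_def)
  next
    case False
    have h: "h w = (if x = w then 1 else 0)" if w: "w \<in> I x y - {y}" for w
    proof -
      have "{z \<in> carrier L. z \<sqsubseteq>\<^bsub>L\<^esub> w} \<subset> {z \<in> carrier L. z \<sqsubseteq>\<^bsub>L\<^esub> y}"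
        using w less.prems by (auto simp: I_def intro: le_trans le_antisym)
      hence "card {z \<in> carrier L. z \<sqsubseteq>\<^bsub>L\<^esub> w} < card {z \<in> carrier L. z \<sqsubseteq>\<^bsub>L\<^esub> y}"
        using fin by (intro psubset_card_mono) auto
      from less.hyps[OF this] w less.prems show ?thesis
        by (simp add: h_def I_def)
    qed
    \<comment> \<open>Summing over w first leaves only z = y, so the total is 1. By induction w = x
      already contributes 1 and every other w below y contributes 0, which forces \<open>h y\<close>
      to be 0.\<close>
    have "(\<Sum>w \<in> I x y. h w) = (\<Sum>z \<in> I x y. \<Sum>w \<in> I z y. mobius L z w)"
      unfolding h_def
    proof (subst (1 2) sum.Sigma)
      show "(\<Sum>(w, z)\<in>Sigma (I x y) (I x). mobius L z w) =
            (\<Sum>(z, w)\<in>(SIGMA z:I x y. I z y). mobius L z w)"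
        by (rule sum.reindex_bij_witness[of _ prod.swap prod.swap])
          (use less.prems in \<open>auto simp: I_def intro: le_trans\<close>)
    qed (use finI in auto)
    also have "\<dots> = (\<Sum>z \<in> I x y. if z = y then 1 else 0)"
      using sum_mobius_interval[OF po fin] less.prems
      by (intro sum.cong) (auto simp: I_def)
    also have "\<dots> = 1"
      using finI[of x y] less.prems by (simp add: I_def)
    finally have total: "(\<Sum>w \<in> I x y. h w) = 1" .
    have "y \<in> I x y" using less.prems by (simp add: I_def)
    hence "(\<Sum>w \<in> I x y. h w) = h y + (\<Sum>w \<in> I x y - {y}. h w)"
      using finI by (subst sum.remove) auto
    also have "(\<Sum>w \<in> I x y - {y}. h w) = (\<Sum>w \<in> I x y - {y}. if x = w then 1 else 0)"
      using h by (intro sum.cong) auto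
    also have "\<dots> = 1"
      using finI[of x y] less.prems False by (subst sum.delta') (auto simp: I_def)
    finally show ?thesis
      using total False by (simp add: h_def I_def)
  qed
qed

lemma mobius_inversion:
  assumes po: "partial_order L" and fin: "finite (carrier L)" and t: "t \<in> carrier L"
  shows "(\<Sum>s \<in> {s \<in> carrier L. s \<sqsubseteq>\<^bsub>L\<^esub> t}. mobius L s t * (\<Sum>u \<in> {u \<in> carrier L. u \<sqsubseteq>\<^bsub>L\<^esub> s}. g u)) = g t"
    (is "?lhs = _")
proof -
  interpret partial_order L by fact
  have "?lhs = (\<Sum>s \<in> {s \<in> carrier L. s \<sqsubseteq>\<^bsub>L\<^esub> t}. \<Sum>u \<in> {u \<in> carrier L. u \<sqsubseteq>\<^bsub>L\<^esub> s}. mobius L s t * g u)"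
    by (simp add: sum_distrib_left)
  also have "\<dots> = (\<Sum>u \<in> {u \<in> carrier L. u \<sqsubseteq>\<^bsub>L\<^esub> t}.
      \<Sum>s \<in> {s \<in> carrier L. u \<sqsubseteq>\<^bsub>L\<^esub> s \<and> s \<sqsubseteq>\<^bsub>L\<^esub> t}. mobius L s t * g u)"
  proof (subst (1 2) sum.Sigma)
    show "(\<Sum>(s, u) \<in> (SIGMA s:{s \<in> carrier L. s \<sqsubseteq>\<^bsub>L\<^esub> t}. {u \<in> carrier L. u \<sqsubseteq>\<^bsub>L\<^esub> s}). mobius L s t * g u) =
      (\<Sum>(u, s) \<in> (SIGMA u:{u \<in> carrier L. u \<sqsubseteq>\<^bsub>L\<^esub> t}. {s \<in> carrier L. u \<sqsubseteq>\<^bsub>L\<^esub> s \<and> s \<sqsubseteq>\<^bsub>L\<^esub> t}). mobius L s t * g u)"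
      by (rule sum.reindex_bij_witness[of _ prod.swap prod.swap])
        (use t in \<open>auto intro: le_trans\<close>)
  qed (use fin in auto)
  also have "\<dots> = (\<Sum>u \<in> {u \<in> carrier L. u \<sqsubseteq>\<^bsub>L\<^esub> t}. (if u = t then 1 else 0) * g u)"
  proof (rule sum.cong[OF HOL.refl])
    fix u assume "u \<in> {u \<in> carrier L. u \<sqsubseteq>\<^bsub>L\<^esub> t}"
    hence "(\<Sum>s \<in> {s \<in> carrier L. u \<sqsubseteq>\<^bsub>L\<^esub> s \<and> s \<sqsubseteq>\<^bsub>L\<^esub> t}. mobius L s t) = (if u = t then 1 else 0)"
      using sum_mobius_interval_dual[OF po fin, of u t] t by simp
    thus "(\<Sum>s \<in> {s \<in> carrier L. u \<sqsubseteq>\<^bsub>L\<^esub> s \<and> s \<sqsubseteq>\<^bsub>L\<^esub> t}. mobius L s t * g u) = (if u = t then 1 else 0) * g u"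
      by (simp only: sum_distrib_right[symmetric])
  qed
  also have "\<dots> = (\<Sum>u \<in> {u \<in> carrier L. u \<sqsubseteq>\<^bsub>L\<^esub> t}. if u = t then g u else 0)"
    by (intro sum.cong) auto
  also have "\<dots> = g t"
    using fin t by (subst sum.delta) auto
  finally show ?thesis .
qed

text \<open>Convexity of \<open>D\<close> makes an interval between two points of \<open>D\<close> a
  full interval of \<open>L\<close>, so both recursions run over the same elements. Taking a convex
  part \<open>D\<close> instead of all of \<open>L\<close> covers filters, with the identity map, as
  well as order ideals transported by \<open>lower_flat\<close>.\<close>

lemma mobius_order_embedding:
  assumes po: "partial_order L" "partial_order K" and fin: "finite (carrier L)"
    and D: "D \<subseteq> carrier L" "f ` D = carrier K"
    and emb: "\<And>x y. x \<in> D \<Longrightarrow> y \<in> D \<Longrightarrow> f x \<sqsubseteq>\<^bsub>K\<^esub> f y \<longleftrightarrow> x \<sqsubseteq>\<^bsub>L\<^esub> y"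
    and convex: "\<And>x y z. x \<in> D \<Longrightarrow> y \<in> D \<Longrightarrow> z \<in> carrier L \<Longrightarrow> x \<sqsubseteq>\<^bsub>L\<^esub> z \<Longrightarrow> z \<sqsubseteq>\<^bsub>L\<^esub> y \<Longrightarrow> z \<in> D"
    and "x \<in> D" "y \<in> D"
  shows "mobius K (f x) (f y) = mobius L x y"
  using assms(8,9)
proof (induction "card {z \<in> carrier L. z \<sqsubseteq>\<^bsub>L\<^esub> y}" arbitrary: y rule: less_induct)
  case less
  interpret L: partial_order L by fact
  interpret K: partial_order K by fact
  have finK: "finite (carrier K)"
    using D fin by (metis finite_imageI finite_subset)
  have inj: "f u = f v \<longleftrightarrow> u = v" if "u \<in> D" "v \<in> D" for u v
  proof
    assume "f u = f v"
    moreover have "f u \<sqsubseteq>\<^bsub>K\<^esub> f u" using D that by auto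
    ultimately have "u \<sqsubseteq>\<^bsub>L\<^esub> v" "v \<sqsubseteq>\<^bsub>L\<^esub> u"
      using emb[of u v] emb[of v u] that by simp_all
    thus "u = v" using D that by (blast intro: L.le_antisym)
  qed simp
  have mem: "u \<in> carrier L" "f u \<in> carrier K" if "u \<in> D" for u
    using D that by auto
  have less_iff: "f u \<sqsubset>\<^bsub>K\<^esub> f v \<longleftrightarrow> u \<sqsubset>\<^bsub>L\<^esub> v" if "u \<in> D" "v \<in> D" for u v
    using that emb inj by (simp add: lless_def L.eq_is_equal K.eq_is_equal)
  let ?J = "{z \<in> carrier L. x \<sqsubseteq>\<^bsub>L\<^esub> z \<and> z \<sqsubset>\<^bsub>L\<^esub> y}"
  have JD: "?J \<subseteq> D"
    using convex[OF \<open>x \<in> D\<close> \<open>y \<in> D\<close>] by (auto simp: lless_def)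
  have J: "{z \<in> carrier K. f x \<sqsubseteq>\<^bsub>K\<^esub> z \<and> z \<sqsubset>\<^bsub>K\<^esub> f y} = f ` ?J" (is "?A = ?B")
  proof
    show "?A \<subseteq> ?B"
    proof
      fix w assume w: "w \<in> ?A"
      then obtain z where z: "w = f z" "z \<in> D" using D(2) by force
      thus "w \<in> ?B" using w emb[OF \<open>x \<in> D\<close>] less_iff[OF _ \<open>y \<in> D\<close>] mem(1) by auto
    qed
    show "?B \<subseteq> ?A"
    proof
      fix w assume "w \<in> ?B"
      then obtain z where z: "w = f z" "z \<in> ?J" by auto
      hence "z \<in> D" using JD by auto
      thus "w \<in> ?A" using z emb[OF \<open>x \<in> D\<close>] less_iff[OF _ \<open>y \<in> D\<close>] mem by simp
    qed
  qed
  have "(\<Sum>z \<in> f ` ?J. mobius K (f x) z) = (\<Sum>z \<in> ?J. mobius K (f x) (f z))"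
    using JD inj by (subst sum.reindex) (auto simp: inj_on_def)
  also have "\<dots> = (\<Sum>z \<in> ?J. mobius L x z)"
  proof (rule sum.cong[OF refl])
    fix z assume z: "z \<in> ?J"
    hence zy: "z \<in> carrier L" "z \<sqsubseteq>\<^bsub>L\<^esub> y" "z \<noteq> y" "y \<in> carrier L"
      using mem[OF \<open>y \<in> D\<close>] by (auto simp: lless_def L.eq_is_equal)
    have "{w \<in> carrier L. w \<sqsubseteq>\<^bsub>L\<^esub> z} \<subset> {w \<in> carrier L. w \<sqsubseteq>\<^bsub>L\<^esub> y}"
      using zy by (auto intro: L.le_trans L.le_antisym)
    hence "card {w \<in> carrier L. w \<sqsubseteq>\<^bsub>L\<^esub> z} < card {w \<in> carrier L. w \<sqsubseteq>\<^bsub>L\<^esub> y}"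
      using fin by (intro psubset_card_mono) auto
    thus "mobius K (f x) (f z) = mobius L x z"
      using less.hyps[of z] \<open>x \<in> D\<close> JD z by blast
  qed
  finally show ?case
    using po fin finK mem[OF \<open>x \<in> D\<close>] mem[OF \<open>y \<in> D\<close>] emb[OF \<open>x \<in> D\<close> \<open>y \<in> D\<close>] inj[OF \<open>x \<in> D\<close> \<open>y \<in> D\<close>]
    unfolding mobius.simps[of K "f x" "f y"] mobius.simps[of L x y] J by simp
qed


section \<open>Ranks\<close>

lemma rank_eqI:
  assumes fin: "finite (carrier L)"
    and upper: "\<And>C. C \<subseteq> {y \<in> carrier L. y \<sqsubseteq>\<^bsub>L\<^esub> x} \<Longrightarrow> Complete_Partial_Order.chain (le L) C \<Longrightarrow> card C \<le> Suc k"
    and witness: "C \<subseteq> {y \<in> carrier L. y \<sqsubseteq>\<^bsub>L\<^esub> x}" "Complete_Partial_Order.chain (le L) C" "card C = Suc k"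
  shows "rank L x = k"
proof -
  have "Max (card ` {C. C \<subseteq> carrier (principal_ideal L x) \<and> Complete_Partial_Order.chain (le L) C}) = Suc k"
    using assms by (intro Max_eqI) (auto simp: image_iff intro!: exI[of _ C])
  thus ?thesis by (simp add: rank_def)
qed

lemma rank_witness:
  assumes "finite (carrier L)" "x \<in> carrier L" "x \<sqsubseteq>\<^bsub>L\<^esub> x"
  obtains C where "C \<subseteq> {y \<in> carrier L. y \<sqsubseteq>\<^bsub>L\<^esub> x}" "Complete_Partial_Order.chain (le L) C"
    "card C = Suc (rank L x)"
proof -
  let ?C = "{C. C \<subseteq> carrier (principal_ideal L x) \<and> Complete_Partial_Order.chain (le L) C}"
  have fin: "finite ?C"
    using assms by (intro finite_subset[of ?C "Pow (carrier L)"]) auto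
  \<comment> \<open>This chain keeps the maximum positive, so the truncated subtraction in
    \<open>rank\<close> loses nothing.\<close>
  have x: "{x} \<in> ?C"
    using assms by (auto simp: Complete_Partial_Order.chain_def)
  hence "Max (card ` ?C) \<in> card ` ?C"
    using fin by (intro Max_in) auto
  moreover have "card {x} \<le> Max (card ` ?C)"
    using fin x by (intro Max_ge finite_imageI imageI)
  ultimately show ?thesis
    using that by (auto simp: rank_def)
qed

lemma card_chain_le_rank:
  assumes "finite (carrier L)" "C \<subseteq> {y \<in> carrier L. y \<sqsubseteq>\<^bsub>L\<^esub> x}" "Complete_Partial_Order.chain (le L) C"
  shows "card C \<le> Suc (rank L x)"
proof -
  let ?C = "{C. C \<subseteq> carrier (principal_ideal L x) \<and> Complete_Partial_Order.chain (le L) C}"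
  have fin: "finite ?C"
    using assms by (intro finite_subset[of ?C "Pow (carrier L)"]) auto
  have "card C \<le> Max (card ` ?C)"
    using assms fin by (intro Max_ge) auto
  thus ?thesis by (simp add: rank_def)
qed

lemma rank_less:
  assumes "partial_order L" and fin: "finite (carrier L)"
    and "x \<in> carrier L" "y \<in> carrier L" "x \<sqsubseteq>\<^bsub>L\<^esub> y" "x \<noteq> y"
  shows "rank L x < rank L y"
proof -
  interpret partial_order L by fact
  obtain C where C: "C \<subseteq> {z \<in> carrier L. z \<sqsubseteq>\<^bsub>L\<^esub> x}" "Complete_Partial_Order.chain (le L) C"
    "card C = Suc (rank L x)"
    using assms by (auto elim: rank_witness)
  have "y \<notin> C"
    using C(1) assms by (auto intro: le_antisym)
  moreover have "finite C"
    using C(1) fin by (auto intro: finite_subset)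
  ultimately have "Suc (Suc (rank L x)) = card (insert y C)"
    using C by simp
  also have "\<dots> \<le> Suc (rank L y)"
  proof (rule card_chain_le_rank[OF fin])
    show "insert y C \<subseteq> {z \<in> carrier L. z \<sqsubseteq>\<^bsub>L\<^esub> y}"
      using C(1) assms by (auto intro: le_trans)
    show "Complete_Partial_Order.chain (le L) (insert y C)"
      using C(1,2) assms by (auto simp: Complete_Partial_Order.chain_def intro: le_trans)
  qed
  finally show ?thesis by simp
qed

lemma rank_principal_ideal:
  assumes "partial_order L" "s \<in> carrier L" "x \<in> carrier L" "x \<sqsubseteq>\<^bsub>L\<^esub> s"
  shows "rank (principal_ideal L s) x = rank L x"
proof -
  interpret partial_order L by fact
  have "{y \<in> carrier L. y \<sqsubseteq>\<^bsub>L\<^esub> s \<and> y \<sqsubseteq>\<^bsub>L\<^esub> x} = {y \<in> carrier L. y \<sqsubseteq>\<^bsub>L\<^esub> x}"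
    using assms by (auto intro: le_trans)
  thus ?thesis by (simp add: rank_def conj_assoc)
qed


section \<open>Independent sets of atoms\<close>

locale finite_geometric_semilattice = geometric_semilattice M for M (structure) +
  assumes finite_carrier: "finite (carrier M)"
begin

text \<open>A common upper bound is asked for instead of a join because this is visibly inherited by
  smaller elements; \<open>bounded_join\<close> recovers the join when it is needed.\<close>

definition joinable :: "'a \<Rightarrow> 'a \<Rightarrow> bool" where
  "joinable x y \<longleftrightarrow> (\<exists>u \<in> carrier M. x \<sqsubseteq> u \<and> y \<sqsubseteq> u)"

text \<open>A matroid basis of the ideal below \<open>z\<close>. Making the join an argument keeps
  the choice operator in the supremum out of the exchange arguments.\<close>

definition basis :: "'a set \<Rightarrow> 'a \<Rightarrow> bool" where
  "basis J z \<longleftrightarrow> J \<subseteq> atoms M \<and> is_lub M z J \<and> rank M z = card J"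

text \<open>The atoms outside it are those whose join with \<open>s\<close> exists and lies strictly
  above \<open>s\<close>, as in the conclusion of axiom (b). The symbol \<open>None\<close> is left
  out because it belongs to every \<open>upper_flat\<close>.\<close>

definition flat :: "'a \<Rightarrow> 'a set" where
  "flat s = {a \<in> atoms M. a \<sqsubseteq> s \<or> \<not> joinable a s}"

lemma upper_flat_eq:
  assumes "s \<in> carrier M"
  shows "upper_flat M s = insert None (Some ` flat s)"
proof -
  have "Upper M {a, s} = {u \<in> carrier M. a \<sqsubseteq> u \<and> s \<sqsubseteq> u}" if "a \<in> atoms M" for a
    using that assms by (auto simp: Upper_def atoms_def)
  hence "atoms_below M s \<union> atoms_apart M s = flat s"
    unfolding flat_def atoms_below_def atoms_apart_def joinable_def by auto
  thus ?thesis by (simp add: upper_flat_def)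
qed

lemma upper_flat_subset_iff:
  "s \<in> carrier M \<Longrightarrow> t \<in> carrier M \<Longrightarrow> upper_flat M s \<subseteq> upper_flat M t \<longleftrightarrow> flat s \<subseteq> flat t"
  by (auto simp: upper_flat_eq)

lemma lower_flat_subset_upper_flat_iff:
  "s \<in> carrier M \<Longrightarrow> lower_flat M x \<subseteq> upper_flat M s \<longleftrightarrow> atoms_below M x \<subseteq> flat s"
  by (auto simp: upper_flat_eq lower_flat_def)

section \<open>Atoms and joins of bounded pairs\<close>

lemma atom_closed: "a \<in> atoms M \<Longrightarrow> a \<in> carrier M"
  by (simp add: atoms_def)

lemma rank_bottom: "rank M \<bottom> = 0"
proof (rule rank_eqI[where C = "{\<bottom>}"])
  have "{y \<in> carrier M. y \<sqsubseteq> \<bottom>} = {\<bottom>}"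
    by (auto intro: le_antisym)
  thus "card C \<le> Suc 0" if "C \<subseteq> {y \<in> carrier M. y \<sqsubseteq> \<bottom>}" for C
    using that card_mono[of "{\<bottom>}" C] by simp
qed (auto simp: finite_carrier Complete_Partial_Order.chain_def)

lemma rank_atom: "a \<in> atoms M \<Longrightarrow> rank M a = 1"
  using rank_covered_by[of "\<bottom>" a] by (simp add: atoms_def rank_bottom)

lemma bottom_principal_ideal:
  assumes "u \<in> carrier M"
  shows "\<bottom>\<^bsub>principal_ideal M u\<^esub> = \<bottom>"
  using assms
  by (intro bottom_eqI) (auto simp: principal_ideal_def intro!: partial_order_subposet partial_order_axioms)

lemma atoms_principal_ideal:
  assumes "u \<in> carrier M"
  shows "atoms (principal_ideal M u) \<subseteq> atoms_below M u"
  using assms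
  by (auto simp: atoms_def atoms_below_def covered_by_def bottom_principal_ideal lless_def intro: le_trans)

lemma le_iff_atoms_below:
  assumes "x \<in> carrier M" "y \<in> carrier M"
  shows "x \<sqsubseteq> y \<longleftrightarrow> atoms_below M x \<subseteq> atoms_below M y"
proof
  assume "x \<sqsubseteq> y"
  thus "atoms_below M x \<subseteq> atoms_below M y"
    using assms by (auto simp: atoms_below_def atoms_def intro: le_trans)
next
  assume sub: "atoms_below M x \<subseteq> atoms_below M y"
  interpret I: geometric_lattice "principal_ideal M x"
    using assms by (rule_tac geometric_ideals)
  obtain S where S: "S \<subseteq> atoms (principal_ideal M x)" "is_lub (principal_ideal M x) x S"
    using I.atomistic[of x] assms by auto
  \<comment> \<open>Atomisticity is available only inside the ideal of \<open>x\<close>, where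
    \<open>y\<close> need not lie. The meet of \<open>x\<close> and \<open>y\<close> does lie there
    and still bounds all the atoms.\<close>
  obtain g where g: "greatest M g (Lower M {x, y})"
    using inf_of_two_exists assms by blast
  have gx: "g \<in> carrier M" "g \<sqsubseteq> x" "g \<sqsubseteq> y"
    using g assms by (auto dest: greatest_Lower_below)
  have "g \<in> Upper (principal_ideal M x) S"
  proof (rule Upper_memI)
    fix a assume "a \<in> S"
    hence "a \<in> atoms_below M x" "a \<in> atoms_below M y"
      using S(1) sub atoms_principal_ideal assms by blast+
    hence "a \<in> Lower M {x, y}"
      by (auto simp: atoms_below_def atoms_def Lower_def)
    thus "a \<sqsubseteq>\<^bsub>principal_ideal M x\<^esub> g"
      using greatest_le[OF g] by simp
  qed (use gx in auto)
  hence "x \<sqsubseteq> g"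
    using least_le[OF S(2)] by simp
  thus "x \<sqsubseteq> y"
    using gx assms by (blast intro: le_trans)
qed

text \<open>The join is formed in the geometric lattice below \<open>u\<close>, and the rank bound
  is semimodularity there with the rank of the meet dropped. What remains is that the join does not
  depend on the ideal.\<close>

lemma bounded_join:
  assumes "u \<in> carrier M" "x \<in> carrier M" "y \<in> carrier M" "x \<sqsubseteq> u" "y \<sqsubseteq> u"
  obtains j where "is_lub M j {x, y}" "rank M j \<le> rank M x + rank M y"
proof
  let ?I = "principal_ideal M u"
  interpret I: geometric_lattice ?I
    using assms by (rule_tac geometric_ideals)
  let ?j = "x \<squnion>\<^bsub>?I\<^esub> y"
  have xy: "x \<in> carrier ?I" "y \<in> carrier ?I"
    using assms by auto
  have lub: "is_lub ?I ?j {x, y}"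
    by (rule I.joinI[OF _ xy])
  have j: "?j \<in> carrier M" "?j \<sqsubseteq> u" "x \<sqsubseteq> ?j" "y \<sqsubseteq> ?j"
    using I.join_closed[OF xy] least_Upper_above[OF lub] xy by auto
  show "is_lub M ?j {x, y}"
  proof (rule least_UpperI)
    fix v assume v: "v \<in> Upper M {x, y}"
    hence v': "v \<in> carrier M" "x \<sqsubseteq> v" "y \<sqsubseteq> v"
      using assms by (auto simp: Upper_def)
    \<comment> \<open>A competing bound \<open>v\<close> may lie outside the ideal of
      \<open>u\<close>; its meet with \<open>u\<close> lies inside and is still an upper bound of
      both elements.\<close>
    obtain g where g: "greatest M g (Lower M {u, v})"
      using inf_of_two_exists assms v' by blast
    have g': "g \<in> carrier M" "g \<sqsubseteq> u" "g \<sqsubseteq> v"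
      using g assms v' by (auto dest: greatest_Lower_below)
    have "x \<sqsubseteq> g" "y \<sqsubseteq> g"
      using assms v' by (auto intro!: greatest_le[OF g] simp: Lower_def)
    hence "g \<in> Upper ?I {x, y}"
      using g' by (auto simp: Upper_def)
    hence "?j \<sqsubseteq> g"
      using least_le[OF lub] by simp
    thus "?j \<sqsubseteq> v"
      using j g' v' by (blast intro: le_trans)
  qed (use j assms in auto)
  have "rank ?I x + rank ?I y \<ge> rank ?I ?j"
    using I.semimodular[OF xy] by simp
  thus "rank M ?j \<le> rank M x + rank M y"
    using assms j by (simp add: rank_principal_ideal partial_order_axioms)
qed

section \<open>Exchange and extension of bases\<close>

lemma basis_closed: "basis J z \<Longrightarrow> z \<in> carrier M"
  by (auto simp: basis_def)

lemma basis_le: "basis J z \<Longrightarrow> a \<in> J \<Longrightarrow> a \<sqsubseteq> z"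
  using atom_closed by (auto simp: basis_def intro: least_Upper_above)

lemma finite_basis: "basis J z \<Longrightarrow> finite J"
  using finite_carrier atom_closed by (auto simp: basis_def intro: finite_subset)

lemma basis_empty: "basis {} \<bottom>"
  by (simp add: basis_def rank_bottom bottom_least)

lemma basis_exchange:
  assumes "basis J z" "t \<in> carrier M" "rank M t < rank M z"
  obtains a where "a \<in> J" "\<not> a \<sqsubseteq> t" "joinable a t"
proof -
  have "\<Squnion>J = z"
    unfolding sup_def using assms least_unique by (intro some_equality) (auto simp: basis_def)
  hence "independent_atoms M J" "rank M t < rank M (\<Squnion>J)"
    using assms by (auto simp: independent_atoms_def basis_def has_join_def)
  then obtain a where a: "a \<in> J" "\<not> a \<sqsubseteq> t" "has_join M {t, a}"
    using independent_extension assms(2) by blast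
  then obtain j where "is_lub M j {t, a}"
    by (auto simp: has_join_def)
  moreover have "a \<in> carrier M"
    using a assms atom_closed by (auto simp: basis_def)
  ultimately have "joinable a t"
    unfolding joinable_def using assms(2)
    by (intro bexI[of _ j]) (auto dest: least_Upper_above)
  thus thesis using a that by blast
qed

text \<open>The rank grows because the join is strictly larger, and by at most one because of the
  bound in \<open>bounded_join\<close> and the rank of an atom. Hence rank and cardinality stay
  equal.\<close>

lemma basis_insert:
  assumes "basis J z" "a \<in> atoms M" "\<not> a \<sqsubseteq> z" "joinable a z"
  obtains w where "basis (insert a J) w" "is_lub M w {z, a}" "rank M w = Suc (rank M z)"
proof -
  have z: "z \<in> carrier M" and a: "a \<in> carrier M"
    using assms basis_closed atom_closed by auto
  obtain u where "u \<in> carrier M" "a \<sqsubseteq> u" "z \<sqsubseteq> u"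
    using assms by (auto simp: joinable_def)
  then obtain w where w: "is_lub M w {z, a}" "rank M w \<le> rank M z + rank M a"
    using bounded_join[of u z a] a z by blast
  have wc: "w \<in> carrier M" "z \<sqsubseteq> w" "a \<sqsubseteq> w"
    using w(1) a z by (auto dest: least_Upper_above)
  hence "rank M z < rank M w"
    using z assms by (intro rank_less[OF partial_order_axioms finite_carrier]) auto
  hence rw: "rank M w = Suc (rank M z)"
    using w(2) rank_atom[OF assms(2)] by simp
  have J: "J \<subseteq> carrier M" "is_lub M z J"
    using assms(1) atom_closed by (auto simp: basis_def)
  have "is_lub M w (insert a J)"
  proof (rule least_UpperI)
    fix b assume "b \<in> insert a J"
    thus "b \<sqsubseteq> w"
      using wc J z basis_le[OF assms(1)] by (blast intro: le_trans)
  next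
    fix v assume v: "v \<in> Upper M (insert a J)"
    hence "v \<in> Upper M J" "v \<in> carrier M" "a \<sqsubseteq> v"
      using a by (auto simp: Upper_def)
    hence "v \<in> Upper M {z, a}"
      using least_le[OF J(2)] by (auto simp: Upper_def)
    thus "w \<sqsubseteq> v"
      using least_le[OF w(1)] by blast
  qed (use J a wc in auto)
  moreover have "a \<notin> J"
    using basis_le[OF assms(1)] assms(3) by auto
  ultimately have "basis (insert a J) w"
    using assms rw finite_basis[OF assms(1)] by (auto simp: basis_def)
  thus thesis using that w rw by blast
qed

lemma basis_augment:
  assumes "basis J z" "x \<in> carrier M" "z \<sqsubseteq> x"
  obtains K where "basis K x"
  using assms
proof (induction "rank M x - rank M z" arbitrary: J z thesis rule: less_induct)
  case less
  have z: "z \<in> carrier M" using less.prems basis_closed by blast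
  show ?case
  proof (cases "x \<sqsubseteq> z")
    case True
    thus ?thesis using less.prems z le_antisym by blast
  next
    case False
    then obtain a where a: "a \<in> atoms M" "a \<sqsubseteq> x" "\<not> a \<sqsubseteq> z"
      using le_iff_atoms_below[of x z] z less.prems by (auto simp: atoms_below_def)
    moreover have "joinable a z"
      using a less.prems by (auto simp: joinable_def)
    ultimately obtain w where w: "basis (insert a J) w" "is_lub M w {z, a}" "rank M w = Suc (rank M z)"
      using basis_insert less.prems(2) by blast
    have "x \<in> Upper M {z, a}"
      using a less.prems by (auto simp: Upper_def)
    hence "w \<sqsubseteq> x"
      using least_le[OF w(2)] by blast
    moreover have "rank M z < rank M x"
      using z less.prems False by (intro rank_less[OF partial_order_axioms finite_carrier]) auto
    ultimately show ?thesis
      using less.hyps[OF _ less.prems(1) w(1) less.prems(3)] w(3) by simp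
  qed
qed

lemma basis_exists:
  assumes "x \<in> carrier M"
  obtains K where "basis K x"
  using basis_augment[OF basis_empty assms] assms by blast

text \<open>Axiom (b) is iterated, adding one atom of \<open>K\<close> at a time until the rank of
  \<open>t\<close> is reached. The last conclusion records more than membership in \<open>K\<close>:
  an atom below \<open>z\<close>, or without a common bound with \<open>z\<close>, is never added.
  This is how a particular atom can be kept out of \<open>L\<close>.\<close>

lemma basis_extend:
  assumes "basis J z" "basis K t" "rank M z \<le> rank M t"
  obtains L w where "basis L w" "z \<sqsubseteq> w" "rank M w = rank M t"
    "L \<subseteq> J \<union> {k \<in> K. \<not> k \<sqsubseteq> z \<and> joinable k z}"
  using assms(1,3)
proof (induction "rank M t - rank M z" arbitrary: J z thesis rule: less_induct)
  case less
  have z: "z \<in> carrier M" using less.prems basis_closed by blast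
  show ?case
  proof (cases "rank M z = rank M t")
    case True
    thus ?thesis using less.prems(1)[of J z] less.prems z by auto
  next
    case False
    hence lt: "rank M z < rank M t" using less.prems by simp
    then obtain a where a: "a \<in> K" "\<not> a \<sqsubseteq> z" "joinable a z"
      using basis_exchange[OF assms(2) z] by blast
    moreover have aM: "a \<in> atoms M"
      using a assms(2) by (auto simp: basis_def)
    ultimately obtain y where y: "basis (insert a J) y" "is_lub M y {z, a}" "rank M y = Suc (rank M z)"
      using basis_insert less.prems(2) by blast
    have zy: "y \<in> carrier M" "z \<sqsubseteq> y"
      using y z atom_closed[OF aM] by (auto dest: least_Upper_above)
    have closer: "rank M t - rank M y < rank M t - rank M z" "rank M y \<le> rank M t"
      using y(3) lt by auto
    obtain L w where L: "basis L w" "y \<sqsubseteq> w" "rank M w = rank M t"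
      "L \<subseteq> insert a J \<union> {k \<in> K. \<not> k \<sqsubseteq> y \<and> joinable k y}"
      by (rule less.hyps[OF closer(1) _ y(1) closer(2)])
    have Kc: "K \<subseteq> carrier M"
      using assms(2) atom_closed by (auto simp: basis_def)
    have "k \<in> J \<union> {k \<in> K. \<not> k \<sqsubseteq> z \<and> joinable k z}" if k: "k \<in> L" for k
    proof -
      \<comment> \<open>The conditions on atoms added later refer to the larger element
        \<open>y\<close>; both pass down to \<open>z\<close>.\<close>
      have "\<not> k \<sqsubseteq> z \<and> joinable k z" if new: "k \<in> K" "\<not> k \<sqsubseteq> y" "joinable k y"
      proof
        show "\<not> k \<sqsubseteq> z" using new zy z Kc by (blast intro: le_trans)
        obtain u where "u \<in> carrier M" "k \<sqsubseteq> u" "y \<sqsubseteq> u"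
          using new by (auto simp: joinable_def)
        thus "joinable k z"
          unfolding joinable_def using zy z by (blast intro: le_trans)
      qed
      thus ?thesis using L(4) k a by blast
    qed
    moreover have "z \<sqsubseteq> w"
      using L zy z basis_closed by (blast intro: le_trans)
    ultimately show ?thesis
      using less.prems(1)[of L w] L by blast
  qed
qed


section \<open>Parallelism classes\<close>

lemma atoms_below_subset_flat: "atoms_below M s \<subseteq> flat s"
  by (auto simp: atoms_below_def flat_def)

lemma basis_subset_flat: "basis J z \<Longrightarrow> J \<subseteq> flat z"
  using basis_le by (auto simp: basis_def flat_def)

lemma basis_subset_atoms_below: "basis J z \<Longrightarrow> J \<subseteq> atoms_below M z"
  using basis_le by (auto simp: basis_def atoms_below_def)

text \<open>If \<open>z\<close> had larger rank, axiom (b) would give an atom of \<open>J\<close>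
  that properly enlarges \<open>s\<close>, which is precisely what \<open>flat s\<close>
  excludes.\<close>

lemma rank_le_of_basis_subset_flat:
  assumes "basis J z" "s \<in> carrier M" "J \<subseteq> flat s"
  shows "rank M z \<le> rank M s"
proof (rule ccontr)
  assume "\<not> rank M z \<le> rank M s"
  then obtain a where "a \<in> J" "\<not> a \<sqsubseteq> s" "joinable a s"
    using basis_exchange[OF assms(1,2)] by force
  thus False using assms(3) by (auto simp: flat_def)
qed

text \<open>If an atom \<open>c\<close> of the closure of \<open>J\<close> were missing from \<open>flat s\<close>, then \<open>s\<close> and \<open>c\<close> would
  have a join of rank one more than \<open>s\<close>. Extending \<open>J\<close> towards this join never uses \<open>c\<close>,
  so it yields an independent subset of \<open>flat s\<close> that is too large.\<close>

lemma flat_subset_of_basis_subset: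
  assumes J: "basis J z" and s: "s \<in> carrier M" and sub: "J \<subseteq> flat s"
  shows "flat z \<subseteq> flat s"
proof (rule ccontr)
  assume "\<not> flat z \<subseteq> flat s"
  then obtain c where c: "c \<in> atoms M" "c \<sqsubseteq> z \<or> \<not> joinable c z" "\<not> c \<sqsubseteq> s" "joinable c s"
    by (auto simp: flat_def)
  obtain I where I: "basis I s" using basis_exists[OF s] by blast
  obtain t where t: "basis (insert c I) t" "rank M t = Suc (rank M s)"
    using basis_insert[OF I] c by metis
  have "rank M z \<le> rank M t"
    using rank_le_of_basis_subset_flat[OF J s sub] t by simp
  then obtain L w where L: "basis L w" "rank M w = rank M t"
    "L \<subseteq> J \<union> {k \<in> insert c I. \<not> k \<sqsubseteq> z \<and> joinable k z}"
    by (rule basis_extend[OF J t(1)])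
  have "L \<subseteq> J \<union> I" using L(3) c(2) by auto
  hence "L \<subseteq> flat s"
    using sub basis_subset_flat[OF I] by auto
  thus False
    using rank_le_of_basis_subset_flat[OF L(1) s] L(2) t(2) by simp
qed

text \<open>The atoms below \<open>x\<close> include a basis of \<open>x\<close>, and a basis inside
  \<open>flat s\<close> pulls all of \<open>flat x\<close> in, including the atoms that have no
  common bound with \<open>x\<close>.\<close>

lemma atoms_below_subset_flat_iff:
  assumes "x \<in> carrier M" "s \<in> carrier M"
  shows "atoms_below M x \<subseteq> flat s \<longleftrightarrow> flat x \<subseteq> flat s"
proof
  assume sub: "atoms_below M x \<subseteq> flat s"
  obtain J where J: "basis J x" using basis_exists assms by blast
  thus "flat x \<subseteq> flat s"
    using flat_subset_of_basis_subset[OF J assms(2)] basis_subset_atoms_below[OF J] sub by blast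
qed (use atoms_below_subset_flat in blast)

lemma rank_le_of_flat_subset:
  assumes "x \<in> carrier M" "s \<in> carrier M" "flat x \<subseteq> flat s"
  shows "rank M x \<le> rank M s"
  using assms basis_exists[of x] rank_le_of_basis_subset_flat basis_subset_flat by (metis subset_trans)

text \<open>The new element is the join of \<open>x\<close> and \<open>a\<close>. It need not be
  comparable with \<open>s\<close>; only its flat is controlled, through the basis obtained by
  adding \<open>a\<close>.\<close>

lemma flat_extend:
  assumes x: "x \<in> carrier M" and s: "s \<in> carrier M" and sub: "flat x \<subseteq> flat s"
    and a: "a \<in> flat s" "\<not> a \<sqsubseteq> x" "joinable a x"
  obtains z where "z \<in> carrier M" "flat x \<subseteq> flat z" "flat z \<subseteq> flat s" "rank M z = Suc (rank M x)"
proof -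
  obtain J where J: "basis J x" using basis_exists[OF x] by blast
  have aM: "a \<in> atoms M" using a by (simp add: flat_def)
  obtain z where z: "basis (insert a J) z" "rank M z = Suc (rank M x)"
    using basis_insert[OF J aM a(2,3)] by blast
  have zc: "z \<in> carrier M" using basis_closed[OF z(1)] .
  have "flat z \<subseteq> flat s"
    using flat_subset_of_basis_subset[OF z(1) s] basis_subset_flat[OF J] sub a(1) by auto
  moreover have "flat x \<subseteq> flat z"
    using flat_subset_of_basis_subset[OF J zc] basis_subset_flat[OF z(1)] by auto
  ultimately show thesis using that zc z(2) by blast
qed

text \<open>An atom of \<open>s\<close> outside \<open>flat x\<close> would extend \<open>x\<close>
  to an element whose flat is still inside \<open>flat s\<close> but whose rank exceeds that of
  \<open>s\<close>. Thus rank is strictly monotone on flats.\<close>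

lemma flat_eq_of_subset:
  assumes x: "x \<in> carrier M" and s: "s \<in> carrier M" and sub: "flat x \<subseteq> flat s"
    and rank: "rank M x = rank M s"
  shows "flat x = flat s"
proof -
  have "atoms_below M s \<subseteq> flat x"
  proof (rule ccontr)
    assume "\<not> atoms_below M s \<subseteq> flat x"
    then obtain a where "a \<in> flat s" "\<not> a \<sqsubseteq> x" "joinable a x"
      using atoms_below_subset_flat[of s] by (auto simp: flat_def atoms_below_def)
    then obtain z where "z \<in> carrier M" "flat z \<subseteq> flat s" "rank M z = Suc (rank M x)"
      by (rule flat_extend[OF x s sub])
    thus False using rank_le_of_flat_subset[of z s] s rank by simp
  qed
  thus ?thesis using atoms_below_subset_flat_iff[OF s x] sub by blast
qed

text \<open>Exchange against a basis of \<open>s\<close> supplies an atom that enlarges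
  \<open>x\<close> and stays in \<open>flat s\<close>. These unit steps make the chains of flats as
  long as ranks permit.\<close>

lemma flat_interpolate:
  assumes x: "x \<in> carrier M" and s: "s \<in> carrier M" and sub: "flat x \<subseteq> flat s"
    and rank: "rank M x < rank M s"
  obtains z where "z \<in> carrier M" "flat x \<subseteq> flat z" "flat z \<subseteq> flat s" "rank M z = Suc (rank M x)"
proof -
  obtain I where I: "basis I s" using basis_exists[OF s] by blast
  obtain a where a: "a \<in> I" "\<not> a \<sqsubseteq> x" "joinable a x"
    by (rule basis_exchange[OF I x rank])
  hence "a \<in> flat s" using basis_subset_flat[OF I] by blast
  thus thesis
    by (rule flat_extend[OF x s sub _ a(2,3)]) (rule that)
qed

lemma flat_mono:
  assumes "x \<in> carrier M" "y \<in> carrier M" "x \<sqsubseteq> y"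
  shows "flat x \<subseteq> flat y"
  using assms le_iff_atoms_below atoms_below_subset_flat_iff atoms_below_subset_flat by blast

section \<open>Maximal rank\<close>

lemma rank_le_poset_rank: "x \<in> carrier M \<Longrightarrow> rank M x \<le> poset_rank M"
  unfolding poset_rank_def using finite_carrier by (intro Max_ge) auto

text \<open>A basis of \<open>s\<close> is extended towards a basis of some element of top rank. The
  element reached may differ from that one, but it has the same rank and lies above
  \<open>s\<close>.\<close>

lemma maximal_rank_above:
  assumes "s \<in> carrier M"
  obtains t where "t \<in> carrier M" "s \<sqsubseteq> t" "rank M t = poset_rank M"
proof -
  have "poset_rank M \<in> rank M ` carrier M"
    unfolding poset_rank_def using finite_carrier by (intro Max_in) auto
  then obtain m where m: "m \<in> carrier M" "rank M m = poset_rank M" by auto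
  obtain J K where "basis J s" "basis K m" using basis_exists assms m by metis
  moreover have "rank M s \<le> rank M m" using m rank_le_poset_rank[OF assms] by simp
  ultimately show thesis
    using basis_extend[of J s K m] that m(2) basis_closed by metis
qed


section \<open>Ranks in the centralization\<close>

lemma flat_chain:
  assumes "x \<in> carrier M" "s \<in> carrier M" "flat x \<subseteq> flat s"
  shows "\<exists>C. C \<subseteq> {U \<in> upper_flat M ` carrier M. upper_flat M x \<subseteq> U \<and> U \<subseteq> upper_flat M s} \<and>
    Complete_Partial_Order.chain (\<subseteq>) C \<and> card C = Suc (rank M s - rank M x)"
  using assms
proof (induction "rank M s - rank M x" arbitrary: x)
  case 0
  hence "flat x = flat s"
    using flat_eq_of_subset[of x s] rank_le_of_flat_subset[of x s] by simp
  thus ?case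
    using 0 by (intro exI[of _ "{upper_flat M x}"])
      (auto simp: Complete_Partial_Order.chain_def upper_flat_subset_iff)
next
  case (Suc k)
  obtain z where z: "z \<in> carrier M" "flat x \<subseteq> flat z" "flat z \<subseteq> flat s" "rank M z = Suc (rank M x)"
    using flat_interpolate[OF Suc.prems] Suc.hyps by (metis zero_less_Suc zero_less_diff)
  have k: "k = rank M s - rank M z"
    using Suc.hyps(2) z(4) by simp
  obtain C where C: "C \<subseteq> {U \<in> upper_flat M ` carrier M. upper_flat M z \<subseteq> U \<and> U \<subseteq> upper_flat M s}"
    "Complete_Partial_Order.chain (\<subseteq>) C" "card C = Suc k"
    using Suc.hyps(1)[OF k z(1) Suc.prems(2) z(3)] unfolding k[symmetric] by blast
  have sub: "upper_flat M x \<subseteq> upper_flat M z"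
    using z Suc.prems by (simp add: upper_flat_subset_iff)
  have "upper_flat M x \<notin> C"
  proof
    assume "upper_flat M x \<in> C"
    hence "flat z \<subseteq> flat x"
      using C(1) Suc.prems z by (auto simp flip: upper_flat_subset_iff)
    thus False
      using rank_le_of_flat_subset[of z x] z Suc.prems by simp
  qed
  moreover have "finite C"
    using C(3) card_ge_0_finite by force
  ultimately have "card (insert (upper_flat M x) C) = Suc (rank M s - rank M x)"
    using C(3) Suc.hyps(2) by simp
  moreover have "Complete_Partial_Order.chain (\<subseteq>) (insert (upper_flat M x) C)"
  proof (rule chainI)
    have "upper_flat M x \<subseteq> U" if "U \<in> C" for U
      using that C(1) sub by blast
    thus "U \<subseteq> V \<or> V \<subseteq> U"
      if "U \<in> insert (upper_flat M x) C" "V \<in> insert (upper_flat M x) C" for U V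
      using that chainD[OF C(2)] by blast
  qed
  moreover have "insert (upper_flat M x) C \<subseteq>
      {U \<in> upper_flat M ` carrier M. upper_flat M x \<subseteq> U \<and> U \<subseteq> upper_flat M s}"
    using C(1) sub Suc.prems by (auto simp: upper_flat_subset_iff)
  ultimately show ?case by blast
qed

section \<open>The centralization and its localizations\<close>

lemma carrier_centralization: "carrier (centralization M) = upper_flat M ` carrier M"
  and le_centralization: "le (centralization M) = (\<subseteq>)"
  by (simp_all add: centralization_def cone_def)

text \<open>The symbol \<open>None\<close> separates the two kinds of sets, so removing the
  centralization leaves lower flats only. Indexing them by the containment of upper flats lets the
  same classes index both factors of the theorem.\<close>

lemma carrier_localization:
  assumes "s \<in> carrier M"
  shows "carrier (localization M (upper_flat M s)) =
    lower_flat M ` {x \<in> carrier M. upper_flat M x \<subseteq> upper_flat M s}"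
proof -
  have "lower_flat M x \<noteq> upper_flat M y" for x y
    by (auto simp: lower_flat_def upper_flat_def)
  moreover have "lower_flat M x \<subseteq> upper_flat M s \<longleftrightarrow> upper_flat M x \<subseteq> upper_flat M s"
    if "x \<in> carrier M" for x
    using assms that
    by (simp add: lower_flat_subset_upper_flat_iff upper_flat_subset_iff atoms_below_subset_flat_iff)
  ultimately show ?thesis
    unfolding localization_def centralization_def cone_def by auto
qed

lemma partial_order_centralization: "partial_order (centralization M)"
  unfolding centralization_def cone_def
  by (intro partial_order_subposet partial_order_inclusion_poset) simp

lemma rank_filter_centralization:
  assumes s: "s \<in> carrier M" and t: "t \<in> carrier M" and sub: "upper_flat M s \<subseteq> upper_flat M t"
  shows "rank (principal_filter (centralization M) (upper_flat M s)) (upper_flat M t) = rank M t - rank M s"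
proof -
  let ?F = "principal_filter (centralization M) (upper_flat M s)"
  let ?D = "{U \<in> upper_flat M ` carrier M. upper_flat M s \<subseteq> U \<and> U \<subseteq> upper_flat M t}"
  have D: "{U \<in> carrier ?F. U \<sqsubseteq>\<^bsub>?F\<^esub> upper_flat M t} = ?D"
    by (auto simp: carrier_centralization le_centralization)
  obtain C where C: "C \<subseteq> ?D" "Complete_Partial_Order.chain (\<subseteq>) C" "card C = Suc (rank M t - rank M s)"
    using flat_chain[OF s t] sub s t by (auto simp: upper_flat_subset_iff)
  show ?thesis
  proof (rule rank_eqI[where C = C])
    show "finite (carrier ?F)"
      using finite_carrier by (simp add: carrier_centralization)
  next
    fix C assume C: "C \<subseteq> {U \<in> carrier ?F. U \<sqsubseteq>\<^bsub>?F\<^esub> upper_flat M t}"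
      "Complete_Partial_Order.chain (le ?F) C"
    \<comment> \<open>Ranks in \<open>M\<close> of chosen representatives send a chain of flats into
      the integers from \<open>rank M s\<close> to \<open>rank M t\<close>, which bounds its
      length.\<close>
    define \<rho> where "\<rho> = (\<lambda>U. rank M (inv_into (carrier M) (upper_flat M) U))"
    have rep: "inv_into (carrier M) (upper_flat M) U \<in> carrier M"
        "upper_flat M (inv_into (carrier M) (upper_flat M) U) = U" if "U \<in> C" for U
      using that C(1) unfolding D by (auto simp: inv_into_into f_inv_into_f subset_iff)
    have mono: "\<rho> U \<le> \<rho> V \<and> (\<rho> U = \<rho> V \<longrightarrow> U = V)" if "U \<in> C" "V \<in> C" "U \<subseteq> V" for U V
    proof -
      define u v where "u = inv_into (carrier M) (upper_flat M) U" and "v = inv_into (carrier M) (upper_flat M) V"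
      have uv: "u \<in> carrier M" "v \<in> carrier M" "U = upper_flat M u" "V = upper_flat M v"
        using rep that by (auto simp: u_def v_def)
      hence "flat u \<subseteq> flat v" using that by (simp add: upper_flat_subset_iff)
      thus ?thesis
        using rank_le_of_flat_subset[of u v] flat_eq_of_subset[of u v] uv
        unfolding \<rho>_def u_def[symmetric] v_def[symmetric] by (simp add: upper_flat_eq)
    qed
    \<comment> \<open>Members of a chain are comparable, and comparable flats of equal rank
      coincide.\<close>
    have "inj_on \<rho> C"
      using mono C(2) unfolding inj_on_def
      by (auto simp: Complete_Partial_Order.chain_def le_centralization) metis+
    moreover have "\<rho> ` C \<subseteq> {rank M s..rank M t}"
    proof
      fix r assume "r \<in> \<rho> ` C"
      then obtain U where U: "U \<in> C" "r = \<rho> U" by auto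
      define u where "u = inv_into (carrier M) (upper_flat M) U"
      have u: "u \<in> carrier M" "U = upper_flat M u" using rep U by (auto simp: u_def)
      hence "flat s \<subseteq> flat u" "flat u \<subseteq> flat t"
        using U C(1) s t unfolding D by (auto simp flip: upper_flat_subset_iff)
      thus "r \<in> {rank M s..rank M t}"
        using rank_le_of_flat_subset s t u(1) unfolding U(2) \<rho>_def u_def[symmetric] by simp
    qed
    ultimately have "card C \<le> card {rank M s..rank M t}"
      by (intro card_inj_on_le) auto
    moreover have "rank M s \<le> rank M t"
      using sub s t by (simp add: upper_flat_subset_iff rank_le_of_flat_subset)
    ultimately show "card C \<le> Suc (rank M t - rank M s)" by simp
  next
    show "C \<subseteq> {U \<in> carrier ?F. U \<sqsubseteq>\<^bsub>?F\<^esub> upper_flat M t}" using C(1) unfolding D .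
  qed (use C in \<open>auto simp: le_centralization\<close>)
qed

lemma poset_rank_filter_centralization:
  assumes s: "s \<in> carrier M"
  shows "poset_rank (principal_filter (centralization M) (upper_flat M s)) = poset_rank M - rank M s"
proof -
  let ?F = "principal_filter (centralization M) (upper_flat M s)"
  obtain m where m: "m \<in> carrier M" "s \<sqsubseteq> m" "rank M m = poset_rank M"
    using maximal_rank_above[OF s] by blast
  hence "upper_flat M s \<subseteq> upper_flat M m"
    using s by (simp add: upper_flat_subset_iff flat_mono)
  hence "poset_rank M - rank M s \<in> rank ?F ` carrier ?F"
    using m s by (auto simp: image_iff carrier_centralization le_centralization rank_filter_centralization
        intro!: bexI[of _ m])
  moreover have "r \<le> poset_rank M - rank M s" if "r \<in> rank ?F ` carrier ?F" for r
    using that s diff_le_mono[OF rank_le_poset_rank]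
    by (auto simp: carrier_centralization le_centralization rank_filter_centralization)
  moreover have "finite (carrier ?F)"
    using finite_carrier by (simp add: carrier_centralization)
  ultimately show ?thesis
    unfolding poset_rank_def by (intro Max_eqI) (auto simp flip: poset_rank_def)
qed


section \<open>Characteristic polynomials\<close>

text \<open>The point of this form is that the exponent no longer involves \<open>s\<close>, so
  terms from different filters can be collected by \<open>T\<close>.\<close>

lemma characteristic_poly_filter_centralization:
  assumes s: "s \<in> carrier M"
  shows "characteristic_poly (principal_filter (centralization M) (upper_flat M s)) =
    (\<Sum>T \<in> {T \<in> upper_flat M ` carrier M. upper_flat M s \<subseteq> T}.
      monom (mobius (centralization M) (upper_flat M s) T)
        (poset_rank M - rank M (inv_into (carrier M) (upper_flat M) T)))"
proof -
  let ?Z = "centralization M" and ?S = "upper_flat M s"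
  let ?F = "principal_filter ?Z ?S"
  interpret Z: partial_order ?Z by (rule partial_order_centralization)
  have F: "carrier ?F = {T \<in> upper_flat M ` carrier M. ?S \<subseteq> T}"
    by (simp add: carrier_centralization le_centralization)
  have po: "partial_order ?F"
    unfolding principal_filter_def by (rule partial_order_subposet) (auto intro: Z.partial_order_axioms)
  have bot: "\<bottom>\<^bsub>?F\<^esub> = ?S"
    using s by (intro bottom_eqI po) (simp_all add: F le_centralization carrier_centralization)
  show ?thesis
    unfolding characteristic_poly_def F bot
  proof (rule sum.cong[OF HOL.refl])
    fix T assume T: "T \<in> {T \<in> upper_flat M ` carrier M. ?S \<subseteq> T}"
    define t where "t = inv_into (carrier M) (upper_flat M) T"
    have t: "t \<in> carrier M" "T = upper_flat M t"
      using T by (auto simp: t_def inv_into_into f_inv_into_f)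
    \<comment> \<open>With these bounds no subtraction truncates and the offset
      \<open>rank M s\<close> cancels.\<close>
    have "rank M s \<le> rank M t" "rank M t \<le> poset_rank M"
      using T s t rank_le_poset_rank by (auto simp: upper_flat_subset_iff intro: rank_le_of_flat_subset)
    hence "poset_rank ?F - rank ?F T = poset_rank M - rank M t"
      using T s t by (simp add: poset_rank_filter_centralization rank_filter_centralization)
    moreover have "mobius ?F ?S T = mobius ?Z ?S T"
      using mobius_order_embedding[of ?Z ?F "carrier ?F" "\<lambda>x. x" ?S T]
        Z.partial_order_axioms po finite_carrier T s
      by (force simp: carrier_centralization le_centralization)
    ultimately show "monom (mobius ?F ?S T) (poset_rank ?F - rank ?F T) =
        monom (mobius ?Z ?S T) (poset_rank M - rank M (inv_into (carrier M) (upper_flat M) T))"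
      by (simp add: t_def)
  qed
qed

lemma lower_flat_subset_iff:
  assumes "x \<in> carrier M" "y \<in> carrier M"
  shows "lower_flat M x \<subseteq> lower_flat M y \<longleftrightarrow> x \<sqsubseteq> y"
  using assms by (auto simp: lower_flat_def le_iff_atoms_below)

text \<open>The localization is a copy of a down-closed part of \<open>M\<close>, where the Moebius
  values from the bottom are those of \<open>M\<close>. Evaluation at 1 removes the exponents, so
  its ranks need not be known.\<close>

lemma characteristic_poly_localization_1:
  assumes s: "s \<in> carrier M"
  shows "poly (characteristic_poly (localization M (upper_flat M s))) 1 =
    (\<Sum>x \<in> {x \<in> carrier M. upper_flat M x \<subseteq> upper_flat M s}. mobius M \<bottom> x)"
proof -
  let ?K = "localization M (upper_flat M s)" and ?D = "{x \<in> carrier M. upper_flat M x \<subseteq> upper_flat M s}"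
  have K: "carrier ?K = lower_flat M ` ?D" by (rule carrier_localization[OF s])
  have le_K: "le ?K = (\<subseteq>)" by (simp add: localization_def cone_def)
  have po: "partial_order ?K"
    unfolding localization_def by (rule partial_order_subposet) (auto simp: cone_def intro: partial_order_inclusion_poset)
  have mono: "upper_flat M x \<subseteq> upper_flat M y" if "x \<in> carrier M" "y \<in> carrier M" "x \<sqsubseteq> y" for x y
    using that by (simp add: upper_flat_subset_iff flat_mono)
  have bot: "\<bottom> \<in> ?D" using s mono by simp
  have bot_K: "\<bottom>\<^bsub>?K\<^esub> = lower_flat M \<bottom>"
  proof (rule bottom_eqI[OF po])
    show "lower_flat M \<bottom> \<in> carrier ?K" using bot unfolding K by blast
    show "lower_flat M \<bottom> \<sqsubseteq>\<^bsub>?K\<^esub> X" if "X \<in> carrier ?K" for X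
      using that lower_flat_subset_iff[of \<bottom>] unfolding K le_K by fastforce
  qed
  have inj: "inj_on (lower_flat M) ?D"
    using lower_flat_subset_iff le_antisym by (intro inj_onI) (metis (mono_tags, lifting) equalityE mem_Collect_eq)
  have mob: "mobius ?K (lower_flat M \<bottom>) (lower_flat M x) = mobius M \<bottom> x" if "x \<in> ?D" for x
  proof (rule mobius_order_embedding[OF partial_order_axioms po finite_carrier, of ?D])
    show "z \<in> ?D" if "y \<in> ?D" "z \<in> carrier M" "z \<sqsubseteq> y" for y z
      using mono[of z y] that by auto
  qed (use that bot K in \<open>auto simp: le_K lower_flat_subset_iff\<close>)
  have "poly (characteristic_poly ?K) 1 = (\<Sum>X \<in> carrier ?K. mobius ?K \<bottom>\<^bsub>?K\<^esub> X)"
    by (simp add: characteristic_poly_def poly_sum poly_monom)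
  also have "\<dots> = (\<Sum>x \<in> ?D. mobius ?K (lower_flat M \<bottom>) (lower_flat M x))"
    unfolding K bot_K using inj by (simp add: sum.reindex)
  also have "\<dots> = (\<Sum>x \<in> ?D. mobius M \<bottom> x)"
    by (rule sum.cong[OF HOL.refl mob])
  finally show ?thesis .
qed

lemma characteristic_poly_eq_sum_centralization:
  "characteristic_poly M = (\<Sum>S \<in> carrier (centralization M).
     characteristic_poly (principal_filter (centralization M) S) *
     [:poly (characteristic_poly (localization M S)) 1:])"
proof -
  let ?Z = "centralization M"
  define Z where "Z = upper_flat M ` carrier M"
  define g where "g T = (\<Sum>x \<in> {x \<in> carrier M. upper_flat M x = T}. mobius M \<bottom> x)" for T
  define f where "f S = (\<Sum>U \<in> {U \<in> Z. U \<subseteq> S}. g U)" for S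
  \<comment> \<open>The exponent is read off an arbitrary representative of the class; the fact
    \<open>e\<close> below shows that the choice is immaterial.\<close>
  define e where "e T = poset_rank M - rank M (inv_into (carrier M) (upper_flat M) T)" for T
  have finZ: "finite Z" by (simp add: Z_def finite_carrier)
  have e: "e (upper_flat M x) = poset_rank M - rank M x" if x: "x \<in> carrier M" for x
  proof -
    define y where "y = inv_into (carrier M) (upper_flat M) (upper_flat M x)"
    have y: "y \<in> carrier M" "upper_flat M y = upper_flat M x"
      using x by (auto simp: y_def inv_into_into f_inv_into_f)
    hence "flat y \<subseteq> flat x" "flat x \<subseteq> flat y"
      using x by (auto simp flip: upper_flat_subset_iff)
    hence "rank M y = rank M x"
      using rank_le_of_flat_subset x y by (simp add: antisym)
    thus ?thesis by (simp add: e_def y_def)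
  qed
  have f: "poly (characteristic_poly (localization M S)) 1 = f S" if "S \<in> Z" for S
  proof -
    let ?D = "{x \<in> carrier M. upper_flat M x \<subseteq> S}"
    have "poly (characteristic_poly (localization M S)) 1 = (\<Sum>x \<in> ?D. mobius M \<bottom> x)"
      using that characteristic_poly_localization_1 by (auto simp: Z_def)
    also have "\<dots> = (\<Sum>U \<in> {U \<in> Z. U \<subseteq> S}. \<Sum>x \<in> {x \<in> ?D. upper_flat M x = U}. mobius M \<bottom> x)"
      using finite_carrier finZ by (intro sum.group[symmetric]) (auto simp: Z_def)
    also have "\<dots> = f S"
      unfolding f_def g_def by (intro sum.cong HOL.refl) auto
    finally show ?thesis .
  qed
  have "(\<Sum>S \<in> carrier ?Z. characteristic_poly (principal_filter ?Z S) *
      [:poly (characteristic_poly (localization M S)) 1:]) =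
    (\<Sum>S \<in> Z. \<Sum>T \<in> {T \<in> Z. S \<subseteq> T}. monom (mobius ?Z S T * f S) (e T))"
  proof (rule sum.cong)
    fix S assume S: "S \<in> Z"
    have "characteristic_poly (principal_filter ?Z S) = (\<Sum>T \<in> {T \<in> Z. S \<subseteq> T}. monom (mobius ?Z S T) (e T))"
      using S characteristic_poly_filter_centralization by (auto simp: Z_def e_def)
    thus "characteristic_poly (principal_filter ?Z S) * [:poly (characteristic_poly (localization M S)) 1:] =
        (\<Sum>T \<in> {T \<in> Z. S \<subseteq> T}. monom (mobius ?Z S T * f S) (e T))"
      unfolding f[OF S] by (simp only: sum_distrib_right) (simp add: smult_monom mult.commute)
  qed (simp add: carrier_centralization Z_def)
  \<comment> \<open>Since \<open>e T\<close> does not involve \<open>S\<close>, the swap turns the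
    coefficient for each \<open>T\<close> into a Moebius sum with fixed upper argument.\<close>
  also have "\<dots> = (\<Sum>T \<in> Z. \<Sum>S \<in> {S \<in> Z. S \<subseteq> T}. monom (mobius ?Z S T * f S) (e T))"
    by (rule sum.swap_restrict[OF finZ finZ])
  also have "\<dots> = (\<Sum>T \<in> Z. monom (\<Sum>S \<in> {S \<in> Z. S \<subseteq> T}. mobius ?Z S T * f S) (e T))"
    by (simp add: monom_sum)
  also have "\<dots> = (\<Sum>T \<in> Z. monom (g T) (e T))"
  proof (rule sum.cong[OF HOL.refl])
    fix T assume "T \<in> Z"
    hence "(\<Sum>S \<in> {S \<in> Z. S \<subseteq> T}. mobius ?Z S T * f S) = g T"
      using mobius_inversion[OF partial_order_centralization, of T g] finZ
      by (simp add: carrier_centralization le_centralization f_def flip: Z_def)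
    thus "monom (\<Sum>S \<in> {S \<in> Z. S \<subseteq> T}. mobius ?Z S T * f S) (e T) = monom (g T) (e T)"
      by simp
  qed
  \<comment> \<open>All elements of the fibre over \<open>T\<close> have the same rank, so the
    common exponent can be replaced by that of each element.\<close>
  also have "\<dots> = (\<Sum>T \<in> Z. \<Sum>x \<in> {x \<in> carrier M. upper_flat M x = T}. monom (mobius M \<bottom> x) (poset_rank M - rank M x))"
    unfolding g_def monom_sum by (intro sum.cong HOL.refl) (auto simp: e)
  also have "\<dots> = characteristic_poly M"
    unfolding characteristic_poly_def Z_def
    using finite_carrier by (intro sum.group) auto
  finally show ?thesis by simp
qed

end

theorem theorem1p4:
  fixes M :: "('a, 'b) gorder_scheme" and n :: nat
  assumes "geometric_semilattice M" and "finite (carrier M)" and "poset_rank M = n"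
  shows "characteristic_poly M =
    (\<Sum>S \<in> carrier (centralization M).
       characteristic_poly (principal_filter (centralization M) S) *
       [:poly (characteristic_poly (localization M S)) 1:])"
proof -
  interpret finite_geometric_semilattice M
    using assms by (simp add: finite_geometric_semilattice_def finite_geometric_semilattice_axioms_def)
  show ?thesis by (rule characteristic_poly_eq_sum_centralization)
qed

end
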